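(* (Discrete Mountain Pass Lemma.) Let $K$ be a finite connected simplicial complex, let $f:K\to\mathbb{R}$ be a discrete Morse function, and let $v_0,v_1$ be critical vertices of $f$ with $f(v_0)<f(v_1)$. Then there is an edge path $\gamma$ in $K$ from $v_1$ to $v_0$ passing through a critical edge $e$ of $f$ such that $$f(e)=\max_{e'\in\gamma}f(e')=\min_{\gamma'}\ \max_{e'\in\gamma'} f(e'),$$ where the minimum is over all edge paths $\gamma'$ in $K$ from $v_1$ to $v_0$ and the maxima are over the edges of the paths. Moreover $f(e)>f(v_1)$.
   Context: $K$ is identified with its set of (nonempty) simplices; $\alpha^{(p)}$ denotes a simplex of dimension $p$, and $\alpha<\beta$ means $\alpha$ is a proper face of $\beta$. For $f:K\to\mathbb{R}$ put $U(\alpha)=\{\beta^{(p+1)}>\alpha : f(\beta)\le f(\alpha)\}$ and $L(\alpha)=\{\gamma^{(p-1)}<\alpha : f(\gamma)\ge f(\alpha)\}$ for each $\alpha^{(p)}\in K$. The function $f$ is a discrete Morse function if $|U(\alpha)|\le 1$ and $|L(\alpha)|\le 1$ for all $\alpha\in K$. A simplex $\alpha$ is critical if $|U(\alpha)|=|L(\alpha)|=0$. An edge path from $v_1$ to $v_0$ is a sequence of edges $e_1,\dots,e_r$ ($r\ge 1$) with $e_i=\langle u_{i-1},u_i\rangle$, $u_0=v_1$, $u_r=v_0$. *)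

theory Defs
  imports "HOL-Analysis.Analysis"
begin

(* A library simplicial_complex is finite by definition and, being closed under face_of,
   also contains the empty simplex. *)
definition simplices :: "'a::euclidean_space set set \<Rightarrow> 'a set set" where
  "simplices \<K> = \<K> - {{}}"

(* "F facet_of S" says that F is a nonempty face of S with aff_dim F = aff_dim S - 1. *)
definition upper_set :: "'a::euclidean_space set set \<Rightarrow> ('a set \<Rightarrow> real) \<Rightarrow> 'a set \<Rightarrow> 'a set set" where
  "upper_set \<K> f \<alpha> = {\<beta> \<in> simplices \<K>. \<alpha> facet_of \<beta> \<and> f \<beta> \<le> f \<alpha>}"

definition lower_set :: "'a::euclidean_space set set \<Rightarrow> ('a set \<Rightarrow> real) \<Rightarrow> 'a set \<Rightarrow> 'a set set" where
  "lower_set \<K> f \<alpha> = {\<gamma> \<in> simplices \<K>. \<gamma> facet_of \<alpha> \<and> f \<gamma> \<ge> f \<alpha>}"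

definition discrete_Morse :: "'a::euclidean_space set set \<Rightarrow> ('a set \<Rightarrow> real) \<Rightarrow> bool" where
  "discrete_Morse \<K> f \<longleftrightarrow>
     (\<forall>\<alpha> \<in> simplices \<K>. card (upper_set \<K> f \<alpha>) \<le> 1 \<and> card (lower_set \<K> f \<alpha>) \<le> 1)"

definition critical_simplex :: "'a::euclidean_space set set \<Rightarrow> ('a set \<Rightarrow> real) \<Rightarrow> 'a set \<Rightarrow> bool" where
  "critical_simplex \<K> f \<alpha> \<longleftrightarrow>
     \<alpha> \<in> simplices \<K> \<and> card (upper_set \<K> f \<alpha>) = 0 \<and> card (lower_set \<K> f \<alpha>) = 0"

definition edge_path :: "'a::euclidean_space set set \<Rightarrow> 'a \<Rightarrow> 'a \<Rightarrow> 'a set list \<Rightarrow> bool" where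
  "edge_path \<K> a b es \<longleftrightarrow> es \<noteq> [] \<and>
     (\<forall>e \<in> set es. e \<in> simplices \<K> \<and> 1 simplex e) \<and>
     (\<exists>u :: nat \<Rightarrow> 'a. u 0 = a \<and> u (length es) = b \<and>
        (\<forall>i < length es. es ! i = convex hull {u i, u (Suc i)}))"

definition path_max :: "('a set \<Rightarrow> real) \<Rightarrow> 'a set list \<Rightarrow> real" where
  "path_max f es = Max (f ` set es)"

(* There may be infinitely many edge paths, but only finitely many values are minimised
   over, so taking Min of this set is meaningful. *)
lemma finite_path_max_values:
  assumes "simplicial_complex \<K>"
  shows "finite {path_max f es |es. edge_path \<K> a b es}"
proof (rule finite_subset)
  show "{path_max f es |es. edge_path \<K> a b es} \<subseteq> f ` \<K>"
  proof
    fix x assume "x \<in> {path_max f es |es. edge_path \<K> a b es}"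
    then obtain es where es: "x = path_max f es" "edge_path \<K> a b es" by blast
    then have "x \<in> f ` set es"
      unfolding path_max_def edge_path_def by (metis List.finite_set Max_in finite_imageI image_is_empty set_empty)
    then show "x \<in> f ` \<K>"
      using es(2) unfolding edge_path_def simplices_def by auto
  qed
  show "finite (f ` \<K>)"
    using assms unfolding simplicial_complex_def by simp
qed

end

theory Submission
  imports Defs
begin

text \<open>
  Let \<open>m\<close> be the minimax value. Among all edge paths from \<open>v1\<close> to \<open>v0\<close> whose edges have value at
  most \<open>m\<close>, take one that crosses the level \<open>m\<close> as few times as possible. It crosses it at least
  once, and the claim is that every edge \<open>e\<close> of value \<open>m\<close> on it is critical: the Morse condition
  turns any failure into a detour with fewer edges at level \<open>m\<close> (\<open>walk_reduce\<close>).

  If \<open>f \<beta> \<le> f e\<close> for some triangle \<open>\<beta>\<close> over \<open>e\<close>, then \<open>e\<close> is the only facet of \<open>\<beta>\<close> with value at least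
  \<open>f \<beta>\<close>, so the other two sides of \<open>\<beta>\<close> lie strictly below \<open>m\<close> and can replace \<open>e\<close>. If instead
  \<open>f {v} \<ge> f e\<close> for an endpoint \<open>v\<close> of \<open>e\<close>, then \<open>v\<close> is not critical, hence not an end of the path, and
  every edge at \<open>v\<close> other than \<open>e\<close> has value above \<open>f {v} \<ge> m\<close>. So the path can only enter and
  leave \<open>v\<close> through \<open>e\<close>, and this excursion can be cut out.

  Edge paths exist because a partition of the vertices into unlinked classes would separate the
  polyhedron into two disjoint closed sets (\<open>walk_exists\<close>). The strict inequality at the end holds
  because \<open>v1\<close> is critical, so that already the first edge of the path lies above it.
\<close>

section \<open>Vertices and facets of affinely independent hulls\<close>

lemma convex_hull_affine_independent_inject:
  fixes C D :: "'a::euclidean_space set"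
  assumes "\<not> affine_dependent C" "\<not> affine_dependent D" "convex hull C = convex hull D"
  shows "C = D"
  using assms extreme_point_of_convex_hull_affine_independent by (metis subsetI subset_antisym)

lemma convex_hull_pair_eq_iff:
  fixes a b c d :: "'a::euclidean_space"
  shows "convex hull {a,b} = convex hull {c,d} \<longleftrightarrow> {a,b} = {c,d}"
  using convex_hull_affine_independent_inject affine_independent_2 by metis

lemma simplex_1_convex_hull_pair:
  fixes a b :: "'a::euclidean_space"
  assumes "a \<noteq> b"
  shows "1 simplex (convex hull {a,b})"
  unfolding simplex_def using assms
  by (intro exI[of _ "{a,b}"]) auto

lemma simplex_1_convex_hull_pair_neq:
  fixes a b :: "'a::euclidean_space"
  assumes "1 simplex (convex hull {a,b})"
  shows "a \<noteq> b"
proof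
  assume "a = b"
  from assms obtain C where C: "\<not> affine_dependent C" "int (card C) = 2" "convex hull {a,b} = convex hull C"
    unfolding simplex_def by auto
  then have "C = {a,b}"
    by (metis affine_independent_2 convex_hull_affine_independent_inject)
  with C \<open>a = b\<close> show False by simp
qed

lemma facet_of_edge_iff:
  fixes a b :: "'a::euclidean_space"
  assumes "a \<noteq> b"
  shows "F facet_of (convex hull {a,b}) \<longleftrightarrow> F = {a} \<or> F = {b}"
proof -
  have "{a,b} - {a} = {b}" "{a,b} - {b} = {a}" using assms by auto
  then have "(F \<noteq> {} \<and> (\<exists>u. u \<in> {a,b} \<and> F = convex hull ({a,b} - {u}))) \<longleftrightarrow> F = {a} \<or> F = {b}"
    by (metis convex_hull_singleton empty_iff insert_iff)
  then show ?thesis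
    using facet_of_convex_hull_affine_independent[OF affine_independent_2, of F a b] by simp
qed

lemma simplex_over_edge_third_vertex:
  fixes a b :: "'a::euclidean_space"
  assumes "n simplex S" "convex hull {a,b} facet_of S" "a \<noteq> b"
  obtains c where "c \<noteq> a" "c \<noteq> b" "convex hull {a,c} facet_of S" "convex hull {c,b} facet_of S"
proof -
  obtain C where C: "\<not> affine_dependent C" "S = convex hull C"
    using assms(1) by (auto simp: simplex_def)
  obtain c where c: "c \<in> C" "convex hull {a,b} = convex hull (C - {c})"
    using assms(2) C by (auto simp: facet_of_convex_hull_affine_independent)
  have "\<not> affine_dependent (C - {c})"
    using C affine_dependent_subset by blast
  then have "{a,b} = C - {c}"
    using c convex_hull_affine_independent_inject affine_independent_2 by metis
  then have "a \<in> C" "b \<in> C" "c \<noteq> a" "c \<noteq> b" "C - {b} = {a,c}" "C - {a} = {c,b}"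
    using c assms(3) by auto
  then show thesis
    using that[of c] facet_of_convex_hull_affine_independent[OF C(1)] C(2) by (metis convex_hull_eq_empty insert_not_empty)
qed

section \<open>Edge paths as lists of vertices\<close>

text \<open>
  Cutting and splicing is easier on the sequence of vertices than on the sequence of edges, where an
  edge does not record the direction of its traversal. The one-vertex list stands for the constant
  path, which is not an \<^const>\<open>edge_path\<close>.
\<close>

fun walk_edges :: "'a::euclidean_space list \<Rightarrow> 'a set list" where
  "walk_edges (x # y # zs) = convex hull {x,y} # walk_edges (y # zs)"
| "walk_edges _ = []"

lemma walk_edges_append:
  "walk_edges (ps @ a # qs) = walk_edges (ps @ [a]) @ walk_edges (a # qs)"
proof (induction ps)
  case (Cons p ps)
  then show ?case by (cases ps) auto
qed auto

lemma length_walk_edges [simp]: "length (walk_edges xs) = length xs - 1"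
  by (induction xs rule: walk_edges.induct) auto

lemma nth_walk_edges:
  "Suc i < length xs \<Longrightarrow> walk_edges xs ! i = convex hull {xs ! i, xs ! Suc i}"
proof (induction xs arbitrary: i rule: walk_edges.induct)
  case (1 x y zs)
  then show ?case by (cases i) auto
qed auto

definition walk :: "'a::euclidean_space set set \<Rightarrow> 'a \<Rightarrow> 'a \<Rightarrow> 'a list \<Rightarrow> bool" where
  "walk \<K> a b xs \<longleftrightarrow> xs \<noteq> [] \<and> hd xs = a \<and> last xs = b \<and>
     (\<forall>e \<in> set (walk_edges xs). e \<in> simplices \<K> \<and> 1 simplex e)"

lemma edge_path_iff_walk:
  "edge_path \<K> a b es \<longleftrightarrow> es \<noteq> [] \<and> (\<exists>xs. walk \<K> a b xs \<and> walk_edges xs = es)"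
proof
  assume L: "edge_path \<K> a b es"
  then obtain u :: "nat \<Rightarrow> 'a" where u: "u 0 = a" "u (length es) = b"
      "\<And>i. i < length es \<Longrightarrow> es ! i = convex hull {u i, u (Suc i)}"
    unfolding edge_path_def by blast
  define xs where "xs = map u [0..<Suc (length es)]"
  have "walk_edges xs = es"
  proof (rule nth_equalityI)
    show "length (walk_edges xs) = length es" by (simp add: xs_def)
  next
    fix i assume "i < length (walk_edges xs)"
    then have "i < length es" by (simp add: xs_def)
    then have "xs ! i = u i" "xs ! Suc i = u (Suc i)" "Suc i < length xs"
      unfolding xs_def by (auto simp del: upt_Suc)
    then show "walk_edges xs ! i = es ! i"
      using nth_walk_edges u(3)[OF \<open>i < length es\<close>] by metis
  qed
  moreover have "hd xs = a" "last xs = b" "xs \<noteq> []"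
    using u unfolding xs_def by (simp_all add: hd_map last_map del: upt_Suc)
  ultimately show "es \<noteq> [] \<and> (\<exists>xs. walk \<K> a b xs \<and> walk_edges xs = es)"
    using L unfolding walk_def edge_path_def by blast
next
  assume "es \<noteq> [] \<and> (\<exists>xs. walk \<K> a b xs \<and> walk_edges xs = es)"
  then obtain xs where "es \<noteq> []" and xs: "walk \<K> a b xs" "walk_edges xs = es" by blast
  have len: "length xs = Suc (length es)"
    using xs length_walk_edges[of xs] by (auto simp: walk_def)
  moreover have "xs ! 0 = a" "xs ! length es = b"
    using xs len by (auto simp: walk_def hd_conv_nth last_conv_nth)
  ultimately show "edge_path \<K> a b es"
    using xs \<open>es \<noteq> []\<close> nth_walk_edges[of _ xs] unfolding edge_path_def walk_def
    by (intro conjI exI[of _ "\<lambda>i. xs ! i"]) auto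
qed

lemma walk_edges_split:
  "e \<in> set (walk_edges xs) \<Longrightarrow> \<exists>ps a b qs. xs = ps @ a # b # qs \<and> e = convex hull {a,b}"
proof (induction xs rule: walk_edges.induct)
  case (1 x y zs)
  show ?case
  proof (cases "e = convex hull {x,y}")
    case True
    then show ?thesis by (metis append_Nil)
  next
    case False
    then obtain ps a b qs where "y # zs = ps @ a # b # qs" "e = convex hull {a,b}"
      using 1 by auto
    then show ?thesis by (metis append_Cons)
  qed
qed auto

section \<open>Connectedness of the one-skeleton\<close>

lemma walk_extend:
  assumes "walk \<K> a b xs" "convex hull {b,c} \<in> simplices \<K>" "b \<noteq> c"
  shows "walk \<K> a c (xs @ [c])"
proof -
  obtain ys where ys: "xs = ys @ [b]"
    using assms(1) by (metis append_butlast_last_id walk_def)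
  have "walk_edges (xs @ [c]) = walk_edges xs @ [convex hull {b,c}]"
    using walk_edges_append[of ys b "[c]"] ys by simp
  then show ?thesis
    using assms simplex_1_convex_hull_pair by (auto simp: walk_def)
qed

text \<open>
  Two vertices of one simplex span an edge of the complex, so each simplex has its vertices either
  all reachable from \<open>a\<close> or all unreachable. The simplices of the two kinds form closed sets that
  cover the polyhedron. They are disjoint because two simplices that meet share a vertex.
\<close>

lemma walk_exists:
  fixes \<K> :: "'a::euclidean_space set set"
  assumes K: "simplicial_complex \<K>" and conn: "connected (\<Union>\<K>)"
    and a: "{a} \<in> \<K>" and b: "{b} \<in> \<K>"
  shows "\<exists>xs. walk \<K> a b xs"
proof (rule ccontr)
  define C where "C = {x. \<exists>xs. walk \<K> a x xs}"
  assume "\<nexists>xs. walk \<K> a b xs"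
  then have "b \<notin> C" by (simp add: C_def)
  have "walk \<K> a a [a]" by (simp add: walk_def)
  then have "a \<in> C" by (auto simp: C_def)
  have fin: "finite \<K>" and simp: "\<And>S. S \<in> \<K> \<Longrightarrow> \<exists>n. n simplex S"
    and face: "\<And>S F. S \<in> \<K> \<Longrightarrow> F face_of S \<Longrightarrow> F \<in> \<K>"
    and int: "\<And>S T. S \<in> \<K> \<Longrightarrow> T \<in> \<K> \<Longrightarrow> (S \<inter> T) face_of S"
    using K unfolding simplicial_complex_def by blast+
  have cl: "closed S" if "S \<in> \<K>" for S
    using simp[OF that] by (metis compact_imp_closed compact_simplex)
  have extreme: "\<exists>x. x extreme_point_of S" if "S \<in> \<K>" "S \<noteq> {}" for S
    using simp[OF that(1)] that(2) unfolding simplex_def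
    by (metis convex_hull_eq_empty equals0I extreme_point_of_convex_hull_affine_independent)
  have adj: "z \<in> C" if S: "S \<in> \<K>" and x: "x extreme_point_of S" "x \<in> C" and z: "z extreme_point_of S" for S x z
  proof (cases "x = z")
    case False
    obtain V where V: "\<not> affine_dependent V" "S = convex hull V"
      using simp[OF S] by (auto simp: simplex_def)
    then have "{x,z} \<subseteq> V"
      using x z extreme_point_of_convex_hull by blast
    then have "convex hull {x,z} face_of S"
      using V face_of_convex_hull_affine_independent by metis
    then have "convex hull {x,z} \<in> simplices \<K>"
      using face[OF S] by (simp add: simplices_def)
    moreover obtain xs where "walk \<K> a x xs" using x by (auto simp: C_def)
    ultimately have "walk \<K> a z (xs @ [z])" using False walk_extend by blast
    then show ?thesis unfolding C_def by blast
  qed (use x in simp)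
  define A where "A = \<Union>{S \<in> \<K>. \<exists>x\<in>C. x extreme_point_of S}"
  define B where "B = \<Union>{S \<in> \<K>. \<exists>x. x \<notin> C \<and> x extreme_point_of S}"
  have "closed A" "closed B"
    unfolding A_def B_def using fin cl by (auto intro!: closed_Union)
  moreover have "\<Union>\<K> \<subseteq> A \<union> B"
    unfolding A_def B_def using extreme by blast
  moreover have "A \<inter> B \<inter> \<Union>\<K> = {}"
  proof (rule ccontr)
    assume "A \<inter> B \<inter> \<Union>\<K> \<noteq> {}"
    then obtain S T x y p where S: "S \<in> \<K>" "x \<in> C" "x extreme_point_of S" "p \<in> S"
      and T: "T \<in> \<K>" "y \<notin> C" "y extreme_point_of T" "p \<in> T"
      unfolding A_def B_def by blast
    have ST: "(S \<inter> T) face_of S" "(S \<inter> T) face_of T"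
      using int[of S T] int[of T S] S(1) T(1) by (simp_all add: Int_commute)
    then obtain z where "z extreme_point_of (S \<inter> T)"
      using extreme[of "S \<inter> T"] face S T by blast
    then have "z extreme_point_of S" "z extreme_point_of T"
      using ST extreme_point_of_face by blast+
    then show False using adj S T by blast
  qed
  moreover have "a \<in> A" "b \<in> B"
    using a b \<open>a \<in> C\<close> \<open>b \<notin> C\<close> unfolding A_def B_def
    using face_of_refl[of "{a}"] face_of_refl[of "{b}"] by (auto simp: face_of_singleton)
  ultimately show False
    using connected_closedD[OF conn, of A B] a b by blast
qed

section \<open>Bypassing noncritical edges of maximal value\<close>

text \<open>
  Counting the edges of value exactly \<open>m\<close> gives the descent: replacing such an edge by two sides of
  a triangle lowers the count by one although the path gets longer, and cutting out a backtracking
  lowers it by two. The endpoints must be critical so that a backtracking has a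
  neighbouring edge of the path on the other side of its turning point.
\<close>

lemma walk_reduce:
  fixes \<K> :: "'a::euclidean_space set set"
  assumes K: "simplicial_complex \<K>" and M: "discrete_Morse \<K> f"
    and v0: "critical_simplex \<K> f {v0}" and v1: "critical_simplex \<K> f {v1}"
    and xs: "walk \<K> v1 v0 xs" and le: "\<forall>e \<in> set (walk_edges xs). f e \<le> m"
    and e: "e \<in> set (walk_edges xs)" "f e = m" and nc: "\<not> critical_simplex \<K> f e"
  shows "\<exists>ys. walk \<K> v1 v0 ys \<and> (\<forall>e \<in> set (walk_edges ys). f e \<le> m) \<and>
           count_list (map f (walk_edges ys)) m < count_list (map f (walk_edges xs)) m"
proof -
  have fin: "finite (simplices \<K>)" and simp: "\<And>S. S \<in> simplices \<K> \<Longrightarrow> \<exists>n. n simplex S"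
    and facet: "\<And>S F. S \<in> simplices \<K> \<Longrightarrow> F facet_of S \<Longrightarrow> F \<in> simplices \<K>"
    using K unfolding simplicial_complex_def simplices_def facet_of_def by blast+
  have finU: "finite (upper_set \<K> f S)" and finL: "finite (lower_set \<K> f S)" for S
    using fin by (auto simp: upper_set_def lower_set_def)
  have U1: "S = T" if "S \<in> upper_set \<K> f R" "T \<in> upper_set \<K> f R" "R \<in> simplices \<K>" for R S T
    using that M finU[of R] by (metis One_nat_def card_le_Suc0_iff_eq discrete_Morse_def)
  have L1: "S = T" if "S \<in> lower_set \<K> f R" "T \<in> lower_set \<K> f R" "R \<in> simplices \<K>" for R S T
    using that M finL[of R] by (metis One_nat_def card_le_Suc0_iff_eq discrete_Morse_def)
  have U0: "upper_set \<K> f {v0} = {}" "upper_set \<K> f {v1} = {}"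
    using v0 v1 finU by (auto simp: critical_simplex_def)
  obtain ps a b qs where split: "xs = ps @ a # b # qs" and eab: "e = convex hull {a,b}"
    using walk_edges_split[OF e(1)] by blast
  have eK: "e \<in> simplices \<K>" and "1 simplex e" using xs e by (auto simp: walk_def)
  then have "a \<noteq> b" using simplex_1_convex_hull_pair_neq eab by blast
  have edges: "walk_edges xs = walk_edges (ps @ [a]) @ e # walk_edges (b # qs)"
    using walk_edges_append[of ps a "b # qs"] split eab by simp
  from nc eK have "upper_set \<K> f e \<noteq> {} \<or> lower_set \<K> f e \<noteq> {}"
    by (auto simp: critical_simplex_def)
  then consider "upper_set \<K> f e \<noteq> {}" | "{b} \<in> lower_set \<K> f e" | "{a} \<in> lower_set \<K> f e"
    using facet_of_edge_iff[OF \<open>a \<noteq> b\<close>] eab by (fastforce simp: lower_set_def)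
  then show ?thesis
  proof cases
    \<comment> \<open>detour around the triangle \<open>\<beta>\<close>\<close>
    case 1
    then obtain \<beta> where \<beta>: "\<beta> \<in> simplices \<K>" "e facet_of \<beta>" "f \<beta> \<le> m"
      using e by (auto simp: upper_set_def)
    then obtain c where c: "c \<noteq> a" "c \<noteq> b" "convex hull {a,c} facet_of \<beta>" "convex hull {c,b} facet_of \<beta>"
      using simplex_over_edge_third_vertex simp eab \<open>a \<noteq> b\<close> by metis
    have "e \<in> lower_set \<K> f \<beta>" using \<beta> e eK by (auto simp: lower_set_def)
    moreover have "convex hull {a,c} \<noteq> e" "convex hull {c,b} \<noteq> e"
      unfolding eab convex_hull_pair_eq_iff using c(1,2) \<open>a \<noteq> b\<close> by auto
    ultimately have "convex hull {a,c} \<notin> lower_set \<K> f \<beta>" "convex hull {c,b} \<notin> lower_set \<K> f \<beta>"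
      using L1 \<beta>(1) by blast+
    then have lt: "f (convex hull {a,c}) < m" "f (convex hull {c,b}) < m"
      using c(3,4) facet[OF \<beta>(1)] \<beta>(3) by (auto simp: lower_set_def)
    define ys where "ys = ps @ a # c # b # qs"
    have ys: "walk_edges ys = walk_edges (ps @ [a]) @ convex hull {a,c} # convex hull {c,b} # walk_edges (b # qs)"
      using walk_edges_append[of ps a "c # b # qs"] by (simp add: ys_def)
    have "hd ys = hd xs" "last ys = last xs" "ys \<noteq> []"
      by (auto simp: ys_def split hd_append)
    then have "walk \<K> v1 v0 ys"
      using xs c facet[OF \<beta>(1)] simplex_1_convex_hull_pair
      unfolding walk_def ys edges by auto
    then show ?thesis
      using le lt e(2) unfolding edges ys[symmetric]
      by (intro exI[of _ ys]) (auto simp: ys)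
  next
    \<comment> \<open>the path continues from \<open>b\<close>, and it can only return along \<open>e\<close> to \<open>a\<close>\<close>
    case 2
    have be: "e \<in> upper_set \<K> f {b}"
      using 2 eK by (auto simp: upper_set_def lower_set_def)
    have "qs \<noteq> []" using xs split U0 be by (auto simp: walk_def)
    then obtain c qs' where qs: "qs = c # qs'" by (cases qs) auto
    have c: "convex hull {b,c} \<in> simplices \<K>" "f (convex hull {b,c}) \<le> m" "b \<noteq> c"
      using xs le simplex_1_convex_hull_pair_neq[of b c] unfolding walk_def edges qs by auto
    have "convex hull {b,c} \<in> upper_set \<K> f {b}"
      using c 2 e(2) facet_of_edge_iff[OF c(3)] by (auto simp: upper_set_def lower_set_def)
    then have "convex hull {b,c} = e" using U1 be 2 by (auto simp: lower_set_def)
    then have "c = a" using eab convex_hull_pair_eq_iff \<open>a \<noteq> b\<close> by (metis doubleton_eq_iff)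
    define ys where "ys = ps @ a # qs'"
    have ys: "walk_edges ys = walk_edges (ps @ [a]) @ walk_edges (a # qs')"
      using walk_edges_append[of ps a qs'] by (simp add: ys_def)
    have "hd ys = hd xs" "last ys = last xs" "ys \<noteq> []"
      by (auto simp: ys_def split hd_append qs \<open>c = a\<close>)
    then have "walk \<K> v1 v0 ys"
      using xs unfolding walk_def ys edges qs \<open>c = a\<close> by auto
    then show ?thesis
      using le e(2) unfolding edges qs \<open>c = a\<close>
      by (intro exI[of _ ys]) (auto simp: ys)
  next
    \<comment> \<open>mirror image: the path can only have reached \<open>a\<close> along \<open>e\<close> from \<open>b\<close>\<close>
    case 3
    have ae: "e \<in> upper_set \<K> f {a}"
      using 3 eK by (auto simp: upper_set_def lower_set_def)
    have "ps \<noteq> []" using xs split U0 ae by (auto simp: walk_def)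
    then obtain c ps' where ps: "ps = ps' @ [c]" by (metis append_butlast_last_id)
    have edges': "walk_edges xs = walk_edges (ps' @ [c]) @ convex hull {c,a} # e # walk_edges (b # qs)"
      using edges walk_edges_append[of ps' c "[a]"] ps by simp
    have c: "convex hull {c,a} \<in> simplices \<K>" "f (convex hull {c,a}) \<le> m" "c \<noteq> a"
      using xs le simplex_1_convex_hull_pair_neq[of c a] unfolding walk_def edges' by auto
    have "convex hull {c,a} \<in> upper_set \<K> f {a}"
      using c 3 e(2) facet_of_edge_iff[OF c(3)] by (auto simp: upper_set_def lower_set_def)
    then have "convex hull {c,a} = e" using U1 ae 3 by (auto simp: lower_set_def)
    then have "c = b" using eab convex_hull_pair_eq_iff \<open>a \<noteq> b\<close> by (metis doubleton_eq_iff)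
    define ys where "ys = ps' @ b # qs"
    have ys: "walk_edges ys = walk_edges (ps' @ [b]) @ walk_edges (b # qs)"
      using walk_edges_append[of ps' b qs] by (simp add: ys_def)
    have "hd ys = hd xs" "last ys = last xs" "ys \<noteq> []"
      by (auto simp: ys_def split hd_append ps \<open>c = b\<close>)
    then have "walk \<K> v1 v0 ys"
      using xs unfolding walk_def ys edges' \<open>c = b\<close> by auto
    then show ?thesis
      using le e(2) unfolding edges' \<open>c = b\<close>
      by (intro exI[of _ ys]) (auto simp: ys)
  qed
qed

lemma critical_vertex_below_edge:
  assumes "simplicial_complex \<K>" "critical_simplex \<K> f {v}"
    and "e \<in> simplices \<K>" "{v} facet_of e"
  shows "f {v} < f e"
proof -
  have "finite (upper_set \<K> f {v})"
    using assms(1) by (auto simp: simplicial_complex_def upper_set_def simplices_def)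
  then show ?thesis using assms by (auto simp: critical_simplex_def upper_set_def)
qed

section \<open>The mountain pass\<close>

theorem mainTheorem2:
  fixes \<K> :: "'a::euclidean_space set set"
    and f :: "'a set \<Rightarrow> real"
    and v0 v1 :: 'a
  assumes "simplicial_complex \<K>"
    and "connected (\<Union>\<K>)"
    and "discrete_Morse \<K> f"
    and "critical_simplex \<K> f {v0}"
    and "critical_simplex \<K> f {v1}"
    and "f {v0} < f {v1}"
  shows "\<exists>\<gamma> e. edge_path \<K> v1 v0 \<gamma> \<and> e \<in> set \<gamma> \<and> critical_simplex \<K> f e \<and>
           f e = path_max f \<gamma> \<and>
           path_max f \<gamma> = Min {path_max f \<gamma>' |\<gamma>'. edge_path \<K> v1 v0 \<gamma>'} \<and>
           f e > f {v1}"
proof -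
  have "v1 \<noteq> v0" using assms(6) by auto
  have nonempty: "walk_edges xs \<noteq> []" if "walk \<K> v1 v0 xs" for xs
    using that \<open>v1 \<noteq> v0\<close> by (cases xs rule: walk_edges.cases) (auto simp: walk_def)
  have path: "edge_path \<K> v1 v0 (walk_edges xs)" if "walk \<K> v1 v0 xs" for xs
    using that nonempty edge_path_iff_walk by blast
  define V where "V = {path_max f \<gamma> |\<gamma>. edge_path \<K> v1 v0 \<gamma>}"
  define m where "m = Min V"
  have "finite V" unfolding V_def by (rule finite_path_max_values[OF assms(1)])
  have "{v1} \<in> \<K>" "{v0} \<in> \<K>"
    using assms(4,5) by (auto simp: critical_simplex_def simplices_def)
  then obtain ws where "walk \<K> v1 v0 ws"
    using walk_exists assms(1,2) by metis
  then have "V \<noteq> {}" using path by (auto simp: V_def)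
  then have "m \<in> V" using \<open>finite V\<close> by (simp add: m_def)
  then obtain zs where zs: "walk \<K> v1 v0 zs" "path_max f (walk_edges zs) = m"
    by (auto simp: V_def edge_path_iff_walk)
  define low where "low xs \<longleftrightarrow> walk \<K> v1 v0 xs \<and> (\<forall>e \<in> set (walk_edges xs). f e \<le> m)" for xs
  have "low zs"
    using zs unfolding low_def path_max_def by auto
  then obtain xs where xs: "low xs"
    and least: "\<And>ys. low ys \<Longrightarrow> count_list (map f (walk_edges xs)) m \<le> count_list (map f (walk_edges ys)) m"
    using ex_has_least_nat[of low zs "\<lambda>xs. count_list (map f (walk_edges xs)) m"] by blast
  have walk: "walk \<K> v1 v0 xs" and le: "\<forall>e \<in> set (walk_edges xs). f e \<le> m"
    using xs by (auto simp: low_def)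
  have "m \<le> path_max f (walk_edges xs)"
    using \<open>finite V\<close> path[OF walk] by (auto simp: m_def V_def intro!: Min_le)
  moreover have max: "path_max f (walk_edges xs) \<in> f ` set (walk_edges xs)"
    unfolding path_max_def using nonempty[OF walk] by (intro Max_in) auto
  ultimately have m: "path_max f (walk_edges xs) = m" using le by fastforce
  with max obtain e where e: "e \<in> set (walk_edges xs)" "f e = m" by auto
  have "critical_simplex \<K> f e"
    using walk_reduce[OF assms(1,3,4,5) walk le e] least unfolding low_def by (meson not_le)
  moreover have "f {v1} < m"
  proof -
    obtain y ys where xs_eq: "xs = v1 # y # ys"
      using walk nonempty[OF walk] by (cases xs rule: walk_edges.cases) (auto simp: walk_def)
    then have "convex hull {v1,y} \<in> simplices \<K>" "v1 \<noteq> y" "f (convex hull {v1,y}) \<le> m"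
      using walk le simplex_1_convex_hull_pair_neq[of v1 y] by (auto simp: walk_def)
    then show ?thesis
      using critical_vertex_below_edge[OF assms(1,5)] facet_of_edge_iff by fastforce
  qed
  ultimately show ?thesis
    using path[OF walk] e m unfolding m_def V_def by metis
qed

end
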